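(* Let $S$ be an Arf numerical semigroup with multiplicity $5$ and conductor $s>5$. If $s\equiv 4\bmod 5$ and $S=\langle 5,s,s+2,s+3,s+4\rangle$, then $\mathrm{PF}(S)=\{s-5,s-3,s-2,s-1\}$, and the row-factorization matrices are exactly the following $5\times5$ matrices, described by their rows $r_1,\dots,r_5$ in order (where alternatives for different rows are chosen independently). For $s-5$ (one matrix): $r_1=(-1,1,0,0,0)$, $r_2=(\frac{s-9}{5},-1,0,0,1)$, $r_3=(\frac{2s-3}{5},0,-1,0,0)$, $r_4=(\frac{s-4}{5},0,1,-1,0)$, $r_5=(\frac{s-4}{5},0,0,1,-1)$. For $s-3$ (two matrices): $r_1=(-1,0,1,0,0)$, $r_2=(\frac{2s-3}{5},-1,0,0,0)$, $r_3=(\frac{s-4}{5},0,-1,1,0)$, $r_4=(\frac{s-4}{5},0,0,-1,1)$ or $r_4=(0,2,0,-1,0)$, and $r_5=(\frac{s+1}{5},1,0,0,-1)$. For $s-2$ (four matrices): $r_1=(-1,0,0,1,0)$, $r_2=(\frac{s-4}{5},-1,1,0,0)$, $r_3=(\frac{s-4}{5},0,-1,0,1)$ or $r_3=(0,2,-1,0,0)$, $r_4=(\frac{s+1}{5},1,0,-1,0)$, and $r_5=(\frac{2s+2}{5},0,0,0,-1)$ or $r_5=(0,1,1,0,-1)$. For $s-1$ (four matrices): $r_1=(-1,0,0,0,1)$, $r_2=(\frac{s-4}{5},-1,0,1,0)$, $r_3=(\frac{s+1}{5},1,-1,0,0)$, $r_4=(\frac{2s+2}{5},0,0,-1,0)$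 or $r_4=(0,1,1,-1,0)$, and $r_5=(\frac{s+1}{5},0,1,0,-1)$ or $r_5=(0,1,0,1,-1)$.
   Context: A numerical semigroup is a subset $S\subseteq\mathbb{N}_0$ (non-negative integers) containing $0$, closed under addition, with finite complement in $\mathbb{N}_0$; $\langle A\rangle$ is the set of $\mathbb{N}_0$-linear combinations of elements of $A$. The multiplicity is the smallest nonzero element of $S$; the conductor is one plus the greatest integer not in $S$. $S$ is Arf if $s_2+s_3-s_1\in S$ for all $s_1\le s_2\le s_3$ in $S$. $\mathrm{PF}(S)$ is the set of integers $z\notin S$ with $z+x\in S$ for all nonzero $x\in S$. If $n_1<\dots<n_e$ are the minimal generators of $S$, a row-factorization matrix of $f\in\mathrm{PF}(S)$ is an $e\times e$ integer matrix $[a_{ij}]$ with $a_{ii}=-1$, $a_{ij}\in\mathbb{N}_0$ for $i\ne j$, and $f=\sum_{j=1}^e a_{ij}n_j$ for each $i$. *)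

theory Defs
  imports "Jordan_Normal_Form.Matrix"
begin

definition numerical_semigroup :: "nat set \<Rightarrow> bool" where
  "numerical_semigroup S \<longleftrightarrow> 0 \<in> S \<and> (\<forall>x\<in>S. \<forall>y\<in>S. x + y \<in> S) \<and> finite (- S)"

definition generated :: "nat set \<Rightarrow> nat set" where
  "generated A = {\<Sum>a\<in>F. c a * a | c F. finite F \<and> F \<subseteq> A}"

definition multiplicity_of :: "nat set \<Rightarrow> nat" where
  "multiplicity_of S = (LEAST x. x \<in> S \<and> x \<noteq> 0)"

text \<open>The gaps counted here are integers, so that the conductor of the full semigroup is 0.\<close>
definition conductor :: "nat set \<Rightarrow> int" where
  "conductor S = 1 + (GREATEST z. z \<notin> int ` S)"

text \<open>The difference is taken in the naturals; it does not truncate, since the first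
  element is the smallest of the three.\<close>
definition arf :: "nat set \<Rightarrow> bool" where
  "arf S \<longleftrightarrow> (\<forall>s1\<in>S. \<forall>s2\<in>S. \<forall>s3\<in>S. s1 \<le> s2 \<and> s2 \<le> s3 \<longrightarrow> s2 + s3 - s1 \<in> S)"

definition PF :: "nat set \<Rightarrow> int set" where
  "PF S = {z. z \<notin> int ` S \<and> (\<forall>x\<in>S. x \<noteq> 0 \<longrightarrow> z + int x \<in> int ` S)}"

definition minimal_generating_set :: "nat set \<Rightarrow> nat set \<Rightarrow> bool" where
  "minimal_generating_set S A \<longleftrightarrow> generated A = S \<and> (\<forall>B. B \<subset> A \<longrightarrow> generated B \<noteq> S)"

text \<open>Uniqueness is shown in \<open>minimal_generators_eq\<close> below.\<close>
definition minimal_generators :: "nat set \<Rightarrow> nat set" where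
  "minimal_generators S = (THE A. minimal_generating_set S A)"

text \<open>Rows and columns are indexed from 0, so column \<open>j\<close> belongs to the minimal generator
  that is usually called \<open>n\<close> with index \<open>j + 1\<close>.\<close>
definition is_RF_matrix :: "nat set \<Rightarrow> int \<Rightarrow> int mat \<Rightarrow> bool" where
  "is_RF_matrix S f A \<longleftrightarrow> f \<in> PF S \<and>
     (let n = sorted_list_of_set (minimal_generators S); e = length n in
        A \<in> carrier_mat e e \<and>
        (\<forall>i<e. A $$ (i, i) = - 1 \<and>
               (\<forall>j<e. j \<noteq> i \<longrightarrow> 0 \<le> A $$ (i, j)) \<and>
               f = (\<Sum>j<e. A $$ (i, j) * int (n ! j))))"

lemma generated_0: "0 \<in> generated A"
  unfolding generated_def by (rule CollectI, rule exI[of _ "\<lambda>_. 0"], rule exI[of _ "{}"]) auto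

lemma generated_base: "a \<in> A \<Longrightarrow> a \<in> generated A"
  unfolding generated_def by (rule CollectI, rule exI[of _ "\<lambda>_. 1"], rule exI[of _ "{a}"]) auto

lemma generated_add:
  assumes "x \<in> generated A" "y \<in> generated A"
  shows "x + y \<in> generated A"
proof -
  obtain c F where F: "finite F" "F \<subseteq> A" and x: "x = (\<Sum>a\<in>F. c a * a)"
    using assms(1) unfolding generated_def by blast
  obtain d G where G: "finite G" "G \<subseteq> A" and y: "y = (\<Sum>a\<in>G. d a * a)"
    using assms(2) unfolding generated_def by blast
  define c' where "c' a = (if a \<in> F then c a else 0)" for a
  define d' where "d' a = (if a \<in> G then d a else 0)" for a
  have x': "x = (\<Sum>a\<in>F \<union> G. c' a * a)"
    unfolding x by (rule sum.mono_neutral_cong_left) (auto simp: F G c'_def)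
  have y': "y = (\<Sum>a\<in>F \<union> G. d' a * a)"
    unfolding y by (rule sum.mono_neutral_cong_left) (auto simp: F G d'_def)
  have "x + y = (\<Sum>a\<in>F \<union> G. (c' a + d' a) * a)"
    unfolding x' y' by (simp add: sum.distrib algebra_simps)
  then show ?thesis
    unfolding generated_def using F G
    by (intro CollectI exI[of _ "\<lambda>a. c' a + d' a"] exI[of _ "F \<union> G"]) auto
qed

lemma generated_mult: "x \<in> generated A \<Longrightarrow> k * x \<in> generated A"
  by (induction k) (auto intro: generated_0 generated_add)

lemma generated_sum:
  "finite F \<Longrightarrow> (\<And>a. a \<in> F \<Longrightarrow> g a \<in> generated A) \<Longrightarrow> sum g F \<in> generated A"
  by (induction F rule: finite_induct) (auto intro: generated_0 generated_add)

lemma generated_subset: "B \<subseteq> generated A \<Longrightarrow> generated B \<subseteq> generated A"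
  unfolding generated_def[of B] by (auto intro!: generated_sum generated_mult)

lemma generated_mono: "B \<subseteq> A \<Longrightarrow> generated B \<subseteq> generated A"
  by (rule generated_subset) (auto intro: generated_base)

lemma generated_below:
  assumes "x \<in> generated A"
  shows "x \<in> generated {a \<in> A. 0 < a \<and> a \<le> x}"
proof -
  obtain c F where F: "finite F" "F \<subseteq> A" and x: "x = (\<Sum>a\<in>F. c a * a)"
    using assms unfolding generated_def by blast
  have "c a * a \<in> generated {a \<in> A. 0 < a \<and> a \<le> x}" if "a \<in> F" for a
  proof (cases "c a * a = 0")
    case True
    then show ?thesis using generated_0 by metis
  next
    case False
    have "c a * a \<le> x" unfolding x using F that by (intro member_le_sum) auto
    moreover have "a \<le> c a * a" using False by (cases "c a") auto
    ultimately have "a \<le> x" by linarith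
    then show ?thesis using False F that by (intro generated_mult generated_base) auto
  qed
  then have "(\<Sum>a\<in>F. c a * a) \<in> generated {a \<in> A. 0 < a \<and> a \<le> x}"
    using F by (intro generated_sum)
  then show ?thesis using x by simp
qed

lemma minimal_generating_set_subset:
  assumes A: "minimal_generating_set S A" and B: "generated B = S"
  shows "A \<subseteq> B"
proof
  fix a assume a: "a \<in> A"
  show "a \<in> B"
  proof (rule ccontr)
    assume nb: "a \<notin> B"
    have gA: "generated A = S" using A by (simp add: minimal_generating_set_def)
    have "a \<in> generated B" using generated_base[OF a] gA B by simp
    then have "a \<in> generated {b \<in> B. 0 < b \<and> b \<le> a}" by (rule generated_below)
    moreover have "{b \<in> B. 0 < b \<and> b \<le> a} \<subseteq> generated (A - {a})"
    proof
      fix b assume b: "b \<in> {b \<in> B. 0 < b \<and> b \<le> a}"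
      then have "b < a" using nb by (auto simp: le_less)
      have "b \<in> generated A" using b gA B generated_base[of b B] by auto
      then have "b \<in> generated {c \<in> A. 0 < c \<and> c \<le> b}" by (rule generated_below)
      also have "\<dots> \<subseteq> generated (A - {a})" using \<open>b < a\<close> by (intro generated_mono) auto
      finally show "b \<in> generated (A - {a})" .
    qed
    ultimately have "a \<in> generated (A - {a})" using generated_subset by blast
    then have "A \<subseteq> generated (A - {a})" by (auto intro: generated_base)
    then have "generated (A - {a}) = S"
      using generated_subset generated_mono[of "A - {a}" A] gA by blast
    then show False using A a unfolding minimal_generating_set_def by blast
  qed
qed

lemma minimal_generators_eq:
  assumes "minimal_generating_set S A"
  shows "minimal_generators S = A"
  unfolding minimal_generators_def
proof (rule the_equality)
  show "minimal_generating_set S A" by fact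
  fix B assume B: "minimal_generating_set S B"
  have "generated A = S" "generated B = S"
    using assms B by (simp_all add: minimal_generating_set_def)
  then show "B = A"
    using minimal_generating_set_subset assms B by blast
qed

end

theory Submission
  imports Defs
begin

text \<open>
  Modulo 5 the generators \<open>5, s, s + 2, s + 3, s + 4\<close> represent the classes \<open>0, 4, 1, 2, 3\<close>, and
  \<open>s + 1\<close>, the one number missing between \<open>s\<close> and \<open>s + 4\<close>, is a multiple of 5. So \<open>S\<close> consists
  of the multiples of 5 together with everything from \<open>s\<close> on (\<open>generated_eq\<close>). This
  description makes the pseudo-Frobenius numbers and the minimality of the generators immediate
  (\<open>PF_eq\<close>, \<open>minimal_generating_set_S\<close>).

  A row-factorization matrix is an independent choice of rows (\<open>RF_matrices_eq\<close>), and its \<open>i\<close>-th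
  row amounts to a factorization of \<open>f + n\<^sub>i\<close> (in 0-based numbering) that avoids \<open>n\<^sub>i\<close>
  (\<open>rf_rows_eq\<close>). For every \<open>f\<close> in \<open>PF S\<close> the number \<open>f + n\<^sub>i\<close> is at most \<open>2 * s + 3\<close>. A
  factorization of such a small number uses at most two generators other than 5: three of them sum
  to at least \<open>3 * s\<close>, which is larger. If it uses exactly two, these exceed \<open>2 * s\<close> by at most 3,
  which leaves no room for a 5 and only the pairs \<open>s + s\<close>, \<open>s + (s + 2)\<close>, \<open>s + (s + 3)\<close>
  (\<open>factorizations_of_small_numbers\<close>). If it uses at most one, that generator is determined by
  the residue of \<open>f + n\<^sub>i\<close> modulo 5, and the number of 5s follows. Hence each row has one
  candidate of this last kind, and an alternative exactly when \<open>f + n\<^sub>i\<close> is \<open>2 * s\<close>,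
  \<open>2 * s + 2\<close> or \<open>2 * s + 3\<close> and the alternative does not involve \<open>n\<^sub>i\<close>.
\<close>

section \<open>The semigroup, its minimal generators and its pseudo-Frobenius numbers\<close>

lemma generated_least:
  assumes "A \<subseteq> T" "0 \<in> T" "\<And>x y. x \<in> T \<Longrightarrow> y \<in> T \<Longrightarrow> x + y \<in> T"
  shows "generated A \<subseteq> T"
proof -
  have mult: "k * a \<in> T" if "a \<in> T" for k a
    by (induction k) (use assms that in auto)
  have "(\<Sum>a\<in>F. c a * a) \<in> T" if "finite F" "F \<subseteq> A" for c F
    using that by (induction F rule: finite_induct) (use assms mult in auto)
  then show ?thesis unfolding generated_def by auto
qed

context
  fixes s k :: nat
  assumes s: "s = 5 * k + 4" and k: "k \<ge> 1"
begin

lemma generated_eq: "generated {5, s, s + 2, s + 3, s + 4} = {x. 5 dvd x \<or> s \<le> x}"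
proof
  show "generated {5, s, s + 2, s + 3, s + 4} \<subseteq> {x. 5 dvd x \<or> s \<le> x}"
    by (rule generated_least) (auto simp: dvd_add)
  show "{x. 5 dvd x \<or> s \<le> x} \<subseteq> generated {5, s, s + 2, s + 3, s + 4}" (is "_ \<subseteq> ?G")
  proof
    fix x assume x: "x \<in> {x. 5 dvd x \<or> s \<le> x}"
    have add5: "5 * q + g \<in> ?G" if "g \<in> {0, s, s + 2, s + 3, s + 4}" for q g
    proof (rule generated_add)
      show "5 * q \<in> ?G"
        using generated_mult[OF generated_base, of 5 _ q] by (simp add: mult.commute)
      show "g \<in> ?G" using that by (auto intro: generated_0 generated_base)
    qed
    have "\<exists>q. \<exists>g \<in> {0, s, s + 2, s + 3, s + 4}. x = 5 * q + g"
    proof (cases "5 dvd x")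
      case True
      then show ?thesis by auto
    next
      case False
      with x obtain m where m: "x = s + m" by (auto simp: le_iff_add)
      (* Remainder 1 would put x in the class of s + 1, which is divisible by 5. *)
      have "m mod 5 \<noteq> 1" using False unfolding m s by presburger
      then have "m mod 5 \<in> {0, 2, 3, 4}" using mod_less_divisor[of 5 m] by auto
      then have "s + m mod 5 \<in> {0, s, s + 2, s + 3, s + 4}" by auto
      moreover have "x = 5 * (m div 5) + (s + m mod 5)" using m by simp
      ultimately show ?thesis by (intro exI bexI)
    qed
    then show "x \<in> ?G" using add5 by blast
  qed
qed

text \<open>
  A generator \<open>n\<close> is not a sum of two nonzero elements of the semigroup: such a sum is 10 or more,
  and it is divisible by 5 or at least \<open>s + 5\<close>. So removing \<open>n\<close> leaves a set closed under addition.
\<close>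

lemma minimal_generating_set_S:
  "minimal_generating_set (generated {5, s, s + 2, s + 3, s + 4}) {5, s, s + 2, s + 3, s + 4}"
    (is "minimal_generating_set (generated ?A) ?A")
  unfolding minimal_generating_set_def
proof (intro conjI allI impI)
  fix B assume "B \<subset> ?A"
  then obtain n where n: "n \<in> ?A" "n \<notin> B" and B: "B \<subseteq> ?A" by blast
  have "generated B \<subseteq> {x. (5 dvd x \<or> s \<le> x) \<and> x \<noteq> n}"
  proof (rule generated_least)
    show "B \<subseteq> {x. (5 dvd x \<or> s \<le> x) \<and> x \<noteq> n}" using B n by auto
    show "0 \<in> {x. (5 dvd x \<or> s \<le> x) \<and> x \<noteq> n}" using n s by auto
    have 5: "x = 0 \<or> 5 \<le> x" if "5 dvd x \<or> s \<le> x" for x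
      using that s k by (auto dest: dvd_imp_le)
    have "\<not> 5 dvd s" "\<not> 5 dvd (s + 2)" "\<not> 5 dvd (s + 3)" "\<not> 5 dvd (s + 4)"
      unfolding s by presburger+
    then have n': "n = 5 \<or> (\<not> 5 dvd n \<and> n < s + 5)" using n(1) by auto
    fix x y assume x: "x \<in> {x. (5 dvd x \<or> s \<le> x) \<and> x \<noteq> n}"
      and y: "y \<in> {x. (5 dvd x \<or> s \<le> x) \<and> x \<noteq> n}"
    have "x + y \<noteq> n"
    proof
      assume xy: "x + y = n"
      with x y have "x \<noteq> 0" "y \<noteq> 0" by auto
      with 5 x y have "5 \<le> x" "5 \<le> y" by auto
      with n' xy have "\<not> 5 dvd n" "n < s + 5" by auto
      with \<open>5 \<le> x\<close> \<open>5 \<le> y\<close> x y xy show False by auto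
    qed
    then show "x + y \<in> {x. (5 dvd x \<or> s \<le> x) \<and> x \<noteq> n}" using x y by auto
  qed
  then show "generated B \<noteq> generated ?A" using n generated_base[of n ?A] by blast
qed simp

lemma sorted_minimal_generators:
  "sorted_list_of_set (minimal_generators (generated {5, s, s + 2, s + 3, s + 4}))
    = [5, s, s + 2, s + 3, s + 4]"
proof -
  have "sorted_list_of_set (set [5, s, s + 2, s + 3, s + 4]) = [5, s, s + 2, s + 3, s + 4]"
    by (rule sorted_list_of_set.idem_if_sorted_distinct) (use s k in auto)
  then show ?thesis using minimal_generators_eq[OF minimal_generating_set_S] by simp
qed

text \<open>
  A pseudo-Frobenius number \<open>z\<close> is not a multiple of 5, so \<open>z + 5\<close> can lie in the semigroup only
  by reaching \<open>s\<close>; the gap \<open>z\<close> is therefore one of the last five numbers before \<open>s\<close>, of which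
  \<open>s - 4\<close> is divisible by 5. Conversely, every nonzero element of the semigroup is at least 5 and
  lifts these gaps to \<open>s\<close> or beyond.
\<close>

lemma PF_eq:
  "PF (generated {5, s, s + 2, s + 3, s + 4}) = {int s - 5, int s - 3, int s - 2, int s - 1}"
proof -
  have mem: "z \<in> int ` {x. 5 dvd x \<or> s \<le> x} \<longleftrightarrow> 0 \<le> z \<and> (5 dvd z \<or> int s \<le> z)" for z
  proof (cases "0 \<le> z")
    case True
    then obtain m where "z = int m" by (rule nonneg_int_cases)
    then show ?thesis using int_dvd_int_iff[of 5 m] by auto
  qed auto
  show ?thesis
  proof (intro equalityI subsetI)
    fix z assume "z \<in> PF (generated {5, s, s + 2, s + 3, s + 4})"
    then have z: "\<not> (0 \<le> z \<and> (5 dvd z \<or> int s \<le> z))"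
      and add: "\<And>x. 5 dvd x \<or> s \<le> x \<Longrightarrow> x \<noteq> 0 \<Longrightarrow>
        0 \<le> z + int x \<and> (5 dvd (z + int x) \<or> int s \<le> z + int x)"
      unfolding PF_def generated_eq mem by blast+
    have z5: "0 \<le> z + 5" "5 dvd z \<or> int s \<le> z + 5" and "5 dvd (z + int s) \<or> int s \<le> z + int s"
      using add[of 5] add[of s] s by auto
    have "5 dvd int s - 4" "5 \<le> int s" using s k by auto
    (* If z < 0, then z + 5 < s is a multiple of 5 and z + s < s is another; but s is not. *)
    have "0 \<le> z"
    proof (rule ccontr)
      assume neg: "\<not> 0 \<le> z"
      with z5 \<open>5 \<le> int s\<close> have "5 dvd z" by auto
      with \<open>5 dvd (z + int s) \<or> int s \<le> z + int s\<close> neg have "5 dvd int s"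
        using dvd_add_right_iff[of 5 z "int s"] by auto
      with \<open>5 dvd int s - 4\<close> show False by presburger
    qed
    with z z5 have "\<not> 5 dvd z" "z < int s" "int s \<le> z + 5" by auto
    moreover have "z \<noteq> int s - 4" using \<open>\<not> 5 dvd z\<close> \<open>5 dvd int s - 4\<close> by auto
    ultimately show "z \<in> {int s - 5, int s - 3, int s - 2, int s - 1}" by auto
  next
    fix z assume z: "z \<in> {int s - 5, int s - 3, int s - 2, int s - 1}"
    have "5 dvd int s - 4" "5 \<le> int s" using s k by auto
    moreover have "\<not> 5 dvd int s - 5" "\<not> 5 dvd int s - 3" "\<not> 5 dvd int s - 2" "\<not> 5 dvd int s - 1"
      using \<open>5 dvd int s - 4\<close> by presburger+
    ultimately have "\<not> 5 dvd z" "z < int s" "int s - 5 \<le> z" "0 \<le> z" using z by auto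
    moreover have "5 \<le> int x" if "5 dvd x \<or> s \<le> x" "x \<noteq> 0" for x
      using that s k by (auto dest: dvd_imp_le)
    ultimately show "z \<in> PF (generated {5, s, s + 2, s + 3, s + 4})"
      unfolding PF_def generated_eq mem by fastforce
  qed
qed

end

section \<open>Row-factorization matrices as independent choices of rows\<close>

definition rf_rows :: "nat list \<Rightarrow> int \<Rightarrow> nat \<Rightarrow> int list set" where
  "rf_rows n f i = {r. length r = length n \<and> r ! i = - 1 \<and>
     (\<forall>j<length n. j \<noteq> i \<longrightarrow> 0 \<le> r ! j) \<and> f = (\<Sum>j<length n. r ! j * int (n ! j))}"

definition factorizations :: "nat list \<Rightarrow> int \<Rightarrow> int list set" where
  "factorizations n v = {r. length r = length n \<and> (\<forall>x\<in>set r. 0 \<le> x) \<and>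
     v = (\<Sum>j<length n. r ! j * int (n ! j))}"

text \<open>Moving the entry \<open>-1\<close> to the other side of the equation turns a row into a factorization.\<close>

lemma rf_rows_eq:
  assumes i: "i < length n"
  shows "rf_rows n f i =
    (\<Union>r \<in> factorizations n (f + int (n ! i)). if r ! i = 0 then {r[i := - 1]} else {})"
    (is "_ = ?R")
proof (intro equalityI subsetI)
  have sum_update: "(\<Sum>j<length n. r[i := c] ! j * int (n ! j)) =
      (\<Sum>j<length n. r ! j * int (n ! j)) + (c - r ! i) * int (n ! i)"
    if "length r = length n" for r :: "int list" and c
  proof -
    have "(\<Sum>j\<in>{..<length n} - {i}. r[i := c] ! j * int (n ! j)) =
        (\<Sum>j\<in>{..<length n} - {i}. r ! j * int (n ! j))"
      by (rule sum.cong) auto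
    then show ?thesis
      using i that by (simp add: sum.remove[of "{..<length n}" i] algebra_simps)
  qed
  {
    fix r assume r: "r \<in> rf_rows n f i"
    then have "(r[i := 0])[i := - 1] = r" "r[i := 0] ! i = 0"
      using list_update_id[of r i] i by (simp_all add: rf_rows_def)
    moreover have "\<forall>x\<in>set (r[i := 0]). 0 \<le> x"
      using r i by (auto simp: rf_rows_def all_set_conv_all_nth nth_list_update)
    then have "r[i := 0] \<in> factorizations n (f + int (n ! i))"
      using r i by (simp add: rf_rows_def factorizations_def sum_update)
    ultimately show "r \<in> ?R" by (intro UN_I[of "r[i := 0]"]) simp_all
  next
    fix r assume "r \<in> ?R"
    then show "r \<in> rf_rows n f i"
      using i by (auto simp: rf_rows_def factorizations_def sum_update all_set_conv_all_nth
        split: if_splits)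
  }
qed

lemma in_listset_iff: "xs \<in> listset Xs \<longleftrightarrow> list_all2 (\<in>) xs Xs"
proof (induction Xs arbitrary: xs)
  case Nil
  then show ?case by simp
next
  case (Cons X Xs)
  then show ?case by (cases xs) (auto simp: set_Cons_def)
qed

lemma inj_on_mat_of_rows_list:
  "inj_on (mat_of_rows_list m) {R. length R = e \<and> (\<forall>r\<in>set R. length r = m)}"
proof (rule inj_onI)
  fix R R' :: "'a list list"
  assume R: "R \<in> {R. length R = e \<and> (\<forall>r\<in>set R. length r = m)}"
    and R': "R' \<in> {R. length R = e \<and> (\<forall>r\<in>set R. length r = m)}"
    and eq: "mat_of_rows_list m R = mat_of_rows_list m R'"
  show "R = R'"
  proof (rule nth_equalityI)
    show "length R = length R'" using R R' by simp
    fix i assume i: "i < length R"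
    show "R ! i = R' ! i"
    proof (rule nth_equalityI)
      show "length (R ! i) = length (R' ! i)" using R R' i by simp
      fix j assume "j < length (R ! i)"
      with i R R' show "R ! i ! j = R' ! i ! j"
        using arg_cong[OF eq, of "\<lambda>A. A $$ (i, j)"] by (simp add: mat_of_rows_list_def)
    qed
  qed
qed

text \<open>
  The defining conditions constrain each row on its own, so the matrices form a product of the
  sets of admissible rows.
\<close>

lemma RF_matrices_eq:
  assumes f: "f \<in> PF S" and n: "n = sorted_list_of_set (minimal_generators S)"
  shows "{A. is_RF_matrix S f A} =
    mat_of_rows_list (length n) ` listset (map (rf_rows n f) [0..<length n])"
    (is "_ = ?M ` listset ?L")
proof (intro equalityI subsetI)
  fix A assume "A \<in> {A. is_RF_matrix S f A}"
  then have A: "A \<in> carrier_mat (length n) (length n)"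
    and rows: "\<And>i. i < length n \<Longrightarrow> A $$ (i, i) = - 1 \<and>
      (\<forall>j<length n. j \<noteq> i \<longrightarrow> 0 \<le> A $$ (i, j)) \<and> f = (\<Sum>j<length n. A $$ (i, j) * int (n ! j))"
    by (simp_all add: is_RF_matrix_def Let_def n)
  define R where "R = map (\<lambda>i. map (\<lambda>j. A $$ (i, j)) [0..<length n]) [0..<length n]"
  have "A = ?M R" using A by (intro eq_matI) (auto simp: R_def mat_of_rows_list_def)
  moreover have "R \<in> listset ?L"
    using rows by (auto simp: in_listset_iff list_all2_conv_all_nth R_def rf_rows_def)
  ultimately show "A \<in> ?M ` listset ?L" by blast
next
  fix A assume "A \<in> ?M ` listset ?L"
  then obtain R where A: "A = ?M R" and R: "length R = length n"
    "\<And>i. i < length n \<Longrightarrow> R ! i \<in> rf_rows n f i"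
    by (auto simp: in_listset_iff list_all2_conv_all_nth)
  have "A $$ (i, j) = R ! i ! j" if "i < length n" "j < length n" for i j
    using that R(1) by (simp add: A mat_of_rows_list_def)
  moreover have "A \<in> carrier_mat (length n) (length n)"
    using R(1) by (simp add: A mat_of_rows_list_def)
  ultimately show "A \<in> {A. is_RF_matrix S f A}"
    using f R(2) by (simp add: is_RF_matrix_def Let_def n[symmetric] rf_rows_def)
qed

lemma card_RF_matrices:
  assumes "f \<in> PF S" and n: "n = sorted_list_of_set (minimal_generators S)"
  shows "card {A. is_RF_matrix S f A} = card (listset (map (rf_rows n f) [0..<length n]))"
  unfolding RF_matrices_eq[OF assms]
proof (rule card_image, rule inj_on_subset[OF inj_on_mat_of_rows_list[of _ "length n"]])
  show "listset (map (rf_rows n f) [0..<length n])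
    \<subseteq> {R. length R = length n \<and> (\<forall>r\<in>set R. length r = length n)}"
    by (auto simp: in_listset_iff list_all2_conv_all_nth rf_rows_def in_set_conv_nth)
qed

section \<open>The possible rows\<close>

text \<open>
  The coefficients of \<open>s, s + 2, s + 3, s + 4\<close> that can occur in factorizations of numbers up to
  \<open>2 * s + 3\<close>.
\<close>

definition small_tails :: "int list set" where
  "small_tails = {[0, 0, 0, 0], [1, 0, 0, 0], [0, 1, 0, 0], [0, 0, 1, 0], [0, 0, 0, 1],
     [2, 0, 0, 0], [1, 1, 0, 0], [1, 0, 1, 0]}"

text \<open>
  In this form the equation fixes \<open>a\<close> once the tail is given, so that membership reduces to a few
  linear conditions with divisibility by 5.
\<close>

definition small_factorizations :: "nat \<Rightarrow> int \<Rightarrow> int list set" where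
  "small_factorizations s v = {a # t | a t. 0 \<le> a \<and> t \<in> small_tails \<and>
     v = 5 * a + int s * t ! 0 + (int s + 2) * t ! 1 + (int s + 3) * t ! 2 + (int s + 4) * t ! 3}"

text \<open>
  With \<open>m = b + c + d + e\<close> the number is \<open>m * s + 5 * a + 2 * c + 3 * d + 4 * e\<close>; the bound gives
  \<open>m \<le> 2\<close>, and in the case \<open>m = 2\<close> it reads \<open>5 * a + 2 * c + 3 * d + 4 * e \<le> 3\<close>.
\<close>

lemma factorizations_of_small_numbers:
  fixes a b c d e s :: int
  assumes nonneg: "0 \<le> a" "0 \<le> b" "0 \<le> c" "0 \<le> d" "0 \<le> e" and s: "s > 3"
    and le: "5 * a + s * b + (s + 2) * c + (s + 3) * d + (s + 4) * e \<le> 2 * s + 3"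
  shows "[b, c, d, e] \<in> small_tails"
proof -
  define m where "m = b + c + d + e"
  have le': "s * m + 5 * a + 2 * c + 3 * d + 4 * e \<le> 2 * s + 3"
    using le by (simp add: m_def algebra_simps)
  have "m \<le> 2"
  proof (rule ccontr)
    assume "\<not> m \<le> 2"
    then have "s * 3 \<le> s * m" using s by (intro mult_left_mono) auto
    then show False using le' nonneg s by linarith
  qed
  moreover have "0 \<le> m" using nonneg by (simp add: m_def)
  ultimately consider "m = 0" | "m = 1" | "m = 2" by fastforce
  moreover have zero_or_one: "x = 0 \<or> x = 1" if "0 \<le> x" "x \<le> 1" for x :: int
    using that by auto
  ultimately show ?thesis
  proof cases
    case 1
    then show ?thesis using nonneg by (simp add: m_def small_tails_def add_nonneg_eq_0_iff)
  next
    case 2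
    then have sum1: "b + c + d + e = 1" by (simp add: m_def)
    then have "b \<le> 1" "c \<le> 1" "d \<le> 1" "e \<le> 1" using nonneg by linarith+
    then have "b = 0 \<or> b = 1" "c = 0 \<or> c = 1" "d = 0 \<or> d = 1" "e = 0 \<or> e = 1"
      using nonneg zero_or_one by blast+
    then show ?thesis using sum1 by (elim disjE) (simp_all add: small_tails_def)
  next
    case 3
    then have le3: "5 * a + 2 * c + 3 * d + 4 * e \<le> 3" using le' by simp
    have "e \<le> 0" "c \<le> 1" "d \<le> 1" using le3 nonneg by linarith+
    then have "e = 0" "c = 0 \<or> c = 1" "d = 0 \<or> d = 1" using nonneg zero_or_one by auto
    moreover have "b = 2 - c - d - e" using 3 m_def by linarith
    ultimately show ?thesis using le3 nonneg(1) by (elim disjE) (simp_all add: small_tails_def)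
  qed
qed

lemma in_factorizations_5_iff:
  "r \<in> factorizations [n0, n1, n2, n3, n4] v \<longleftrightarrow> (\<exists>a b c d e. r = [a, b, c, d, e] \<and>
     0 \<le> a \<and> 0 \<le> b \<and> 0 \<le> c \<and> 0 \<le> d \<and> 0 \<le> e \<and>
     v = a * int n0 + b * int n1 + c * int n2 + d * int n3 + e * int n4)"
  by (auto simp: factorizations_def length_Suc_conv)

lemma factorizations_eq_small:
  assumes v: "v \<le> 2 * int s + 3" and s: "s > 3"
  shows "factorizations [5, s, s + 2, s + 3, s + 4] v = small_factorizations s v"
proof (intro equalityI subsetI)
  fix r assume "r \<in> factorizations [5, s, s + 2, s + 3, s + 4] v"
  then obtain a b c d e where r: "r = [a, b, c, d, e]"
    and nonneg: "0 \<le> a" "0 \<le> b" "0 \<le> c" "0 \<le> d" "0 \<le> e"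
    and eq: "v = 5 * a + int s * b + (int s + 2) * c + (int s + 3) * d + (int s + 4) * e"
    unfolding in_factorizations_5_iff by (auto simp: mult.commute)
  then have "[b, c, d, e] \<in> small_tails"
    using factorizations_of_small_numbers[OF nonneg, of "int s"] s v by simp
  then show "r \<in> small_factorizations s v"
    using r nonneg(1) eq by (simp add: small_factorizations_def)
next
  fix r assume "r \<in> small_factorizations s v"
  then obtain a t where "0 \<le> a" "t \<in> small_tails" "r = a # t"
    "v = 5 * a + int s * t ! 0 + (int s + 2) * t ! 1 + (int s + 3) * t ! 2 + (int s + 4) * t ! 3"
    by (auto simp: small_factorizations_def)
  moreover from this(2) obtain b c d e where "t = [b, c, d, e]" "0 \<le> b" "0 \<le> c" "0 \<le> d" "0 \<le> e"
    by (auto simp: small_tails_def)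
  ultimately show "r \<in> factorizations [5, s, s + 2, s + 3, s + 4] v"
    by (simp add: in_factorizations_5_iff mult.commute)
qed

text \<open>The rows of \<open>rf_rows_eq\<close>, written with the explicit factorizations.\<close>

definition row_candidates :: "nat \<Rightarrow> int \<Rightarrow> nat \<Rightarrow> int list set" where
  "row_candidates s f i = (\<Union>r \<in> small_factorizations s (f + int ([5, s, s + 2, s + 3, s + 4] ! i)).
     if r ! i = 0 then {r[i := - 1]} else {})"

text \<open>
  The bound of \<open>factorizations_of_small_numbers\<close> applies to every row, because
  \<open>f + n\<^sub>i\<close> is at most \<open>(s - 1) + (s + 4) = 2 * s + 3\<close>.
\<close>

lemma RF_matrices_from_small_factorizations:
  assumes s: "s = 5 * k + 4" and k: "k \<ge> 1"
    and f: "f \<in> PF (generated {5, s, s + 2, s + 3, s + 4})" (is "f \<in> PF ?S")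
  shows "{A. is_RF_matrix ?S f A} = mat_of_rows_list 5 ` listset (map (row_candidates s f) [0..<5]) \<and>
    card {A. is_RF_matrix ?S f A} = card (listset (map (row_candidates s f) [0..<5]))"
proof -
  define n where "n = [5, s, s + 2, s + 3, s + 4]"
  have n: "n = sorted_list_of_set (minimal_generators ?S)" and length_n: "length n = 5"
    using sorted_minimal_generators[OF s k] by (simp_all add: n_def)
  have "rf_rows n f i = row_candidates s f i" if i: "i < 5" for i
  proof -
    have "f < int s" using f PF_eq[OF s k] by auto
    moreover have "n ! i \<le> s + 4"
      using nth_mem[of i n] i length_n s k by (auto simp: n_def)
    ultimately have "f + int (n ! i) \<le> 2 * int s + 3" by linarith
    then have "factorizations n (f + int (n ! i)) = small_factorizations s (f + int (n ! i))"
      unfolding n_def by (rule factorizations_eq_small) (use s k in simp)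
    with rf_rows_eq[of i n f] i length_n show ?thesis
      unfolding row_candidates_def n_def by metis
  qed
  then have "map (rf_rows n f) [0..<length n] = map (row_candidates s f) [0..<5]"
    by (simp add: length_n)
  with RF_matrices_eq[OF f n] card_RF_matrices[OF f n] length_n show ?thesis by metis
qed

section \<open>The classification\<close>

theorem proposition3p11:
  fixes S :: "nat set" and s :: nat
  assumes "numerical_semigroup S"
    and "arf S"
    and "multiplicity_of S = 5"
    and "conductor S = int s"
    and "s > 5"
    and "s mod 5 = 4"
    and "S = generated {5, s, s + 2, s + 3, s + 4}"
  shows "PF S = {int s - 5, int s - 3, int s - 2, int s - 1} \<and>
    {A. is_RF_matrix S (int s - 5) A} =
      {mat_of_rows_list 5
        [[-1, 1, 0, 0, 0],
         [(int s - 9) div 5, -1, 0, 0, 1],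
         [(2 * int s - 3) div 5, 0, -1, 0, 0],
         [(int s - 4) div 5, 0, 1, -1, 0],
         [(int s - 4) div 5, 0, 0, 1, -1]]} \<and>
    {A. is_RF_matrix S (int s - 3) A} =
      {mat_of_rows_list 5
        [[-1, 0, 1, 0, 0],
         [(2 * int s - 3) div 5, -1, 0, 0, 0],
         [(int s - 4) div 5, 0, -1, 1, 0],
         r4,
         [(int s + 1) div 5, 1, 0, 0, -1]] | r4.
        r4 \<in> {[(int s - 4) div 5, 0, 0, -1, 1], [0, 2, 0, -1, 0]}} \<and>
    card {A. is_RF_matrix S (int s - 3) A} = 2 \<and>
    {A. is_RF_matrix S (int s - 2) A} =
      {mat_of_rows_list 5
        [[-1, 0, 0, 1, 0],
         [(int s - 4) div 5, -1, 1, 0, 0],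
         r3,
         [(int s + 1) div 5, 1, 0, -1, 0],
         r5] | r3 r5.
        r3 \<in> {[(int s - 4) div 5, 0, -1, 0, 1], [0, 2, -1, 0, 0]} \<and>
        r5 \<in> {[(2 * int s + 2) div 5, 0, 0, 0, -1], [0, 1, 1, 0, -1]}} \<and>
    card {A. is_RF_matrix S (int s - 2) A} = 4 \<and>
    {A. is_RF_matrix S (int s - 1) A} =
      {mat_of_rows_list 5
        [[-1, 0, 0, 0, 1],
         [(int s - 4) div 5, -1, 0, 1, 0],
         [(int s + 1) div 5, 1, -1, 0, 0],
         r4,
         r5] | r4 r5.
        r4 \<in> {[(2 * int s + 2) div 5, 0, 0, -1, 0], [0, 1, 1, -1, 0]} \<and>
        r5 \<in> {[(int s + 1) div 5, 0, 1, 0, -1], [0, 1, 0, 1, -1]}} \<and>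
    card {A. is_RF_matrix S (int s - 1) A} = 4"
proof -
  define k where "k = s div 5"
  have s: "s = 5 * k + 4" and k: "k \<ge> 1"
    using assms(5,6) div_mult_mod_eq[of s 5] by (auto simp: k_def)
  have coeffs: "(int s - 9) div 5 = int k - 1" "(int s - 4) div 5 = int k"
    "(int s + 1) div 5 = int k + 1" "(2 * int s - 3) div 5 = 2 * int k + 1"
    "(2 * int s + 2) div 5 = 2 * int k + 2"
    using s by auto
  have PF: "PF S = {int s - 5, int s - 3, int s - 2, int s - 1}"
    using PF_eq[OF s k] by (simp add: assms(7))
  note matrices = RF_matrices_from_small_factorizations[OF s k, folded assms(7)]
  note mats = matrices[THEN conjunct1] and cards = matrices[THEN conjunct2]
  have int_s: "int s = 5 * int k + 4" using s by simp
  (* The forms in which a wrong residue modulo 5 shows up after linear normalization. *)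
  have not_multiple_of_5: "5 * x + c \<noteq> 5 * a" "c + 5 * x \<noteq> 5 * a" "10 * x + c \<noteq> 5 * a"
    "c + 10 * x \<noteq> 5 * a" "5 * x \<noteq> 5 * a + c" "5 * x \<noteq> c + 5 * a" "10 * x \<noteq> 5 * a + c"
    "10 * x \<noteq> c + 5 * a" "5 * a + c \<noteq> 0" "c + 5 * a \<noteq> 0" "5 * a \<noteq> c"
    if "c mod 5 \<noteq> 0" for a c x :: int
  proof -
    have "5 * x + c \<noteq> 5 * a" for x a
    proof
      assume "5 * x + c = 5 * a"
      then have "c = 5 * (a - x)" by simp
      with that show False by simp
    qed
    from this[of x a] this[of "2 * x" a] this[of a x, symmetric]
      this[of a "2 * x", symmetric] this[of a 0] this[of 0 a, symmetric]
    show "5 * x + c \<noteq> 5 * a" "c + 5 * x \<noteq> 5 * a" "10 * x + c \<noteq> 5 * a"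
      "c + 10 * x \<noteq> 5 * a" "5 * x \<noteq> 5 * a + c" "5 * x \<noteq> c + 5 * a" "10 * x \<noteq> 5 * a + c"
      "10 * x \<noteq> c + 5 * a" "5 * a + c \<noteq> 0" "c + 5 * a \<noteq> 0" "5 * a \<noteq> c"
      by (simp_all add: add.commute)
  qed
  have in_small_factorizations: "r \<in> small_factorizations s v \<longleftrightarrow>
      (\<exists>a\<ge>0. \<exists>t\<in>small_tails. r = a # t \<and>
        v = 5 * a + int s * t ! 0 + (int s + 2) * t ! 1 + (int s + 3) * t ! 2 + (int s + 4) * t ! 3)"
    for r v by (auto simp: small_factorizations_def)
  (* Each set comes from trying the eight tails and discarding the wrong residues. Among these
     numbers, those with two factorizations are 2 * s, 2 * s + 2 and 2 * s + 3. *)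
  have factorizations:
    "small_factorizations s (5 * int k + 4) = {[0, 1, 0, 0, 0]}"
    "small_factorizations s (5 * int k + 6) = {[0, 0, 1, 0, 0]}"
    "small_factorizations s (5 * int k + 7) = {[0, 0, 0, 1, 0]}"
    "small_factorizations s (5 * int k + 8) = {[0, 0, 0, 0, 1]}"
    "small_factorizations s (10 * int k + 3) = {[int k - 1, 0, 0, 0, 1]}"
    "small_factorizations s (10 * int k + 5) = {[2 * int k + 1, 0, 0, 0, 0]}"
    "small_factorizations s (10 * int k + 6) = {[int k, 0, 1, 0, 0]}"
    "small_factorizations s (10 * int k + 7) = {[int k, 0, 0, 1, 0]}"
    "small_factorizations s (10 * int k + 8) = {[int k, 0, 0, 0, 1], [0, 2, 0, 0, 0]}"
    "small_factorizations s (10 * int k + 9) = {[int k + 1, 1, 0, 0, 0]}"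
    "small_factorizations s (10 * int k + 10) = {[2 * int k + 2, 0, 0, 0, 0], [0, 1, 1, 0, 0]}"
    "small_factorizations s (10 * int k + 11) = {[int k + 1, 0, 1, 0, 0], [0, 1, 0, 1, 0]}"
    using k by (auto simp: in_small_factorizations int_s small_tails_def not_multiple_of_5)
  have rows:
    "row_candidates s (int s - 5) 0 = {[-1, 1, 0, 0, 0]}"
    "row_candidates s (int s - 5) 1 = {[int k - 1, -1, 0, 0, 1]}"
    "row_candidates s (int s - 5) 2 = {[2 * int k + 1, 0, -1, 0, 0]}"
    "row_candidates s (int s - 5) 3 = {[int k, 0, 1, -1, 0]}"
    "row_candidates s (int s - 5) 4 = {[int k, 0, 0, 1, -1]}"
    "row_candidates s (int s - 3) 0 = {[-1, 0, 1, 0, 0]}"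
    "row_candidates s (int s - 3) 1 = {[2 * int k + 1, -1, 0, 0, 0]}"
    "row_candidates s (int s - 3) 2 = {[int k, 0, -1, 1, 0]}"
    "row_candidates s (int s - 3) 3 = {[int k, 0, 0, -1, 1], [0, 2, 0, -1, 0]}"
    "row_candidates s (int s - 3) 4 = {[int k + 1, 1, 0, 0, -1]}"
    "row_candidates s (int s - 2) 0 = {[-1, 0, 0, 1, 0]}"
    "row_candidates s (int s - 2) 1 = {[int k, -1, 1, 0, 0]}"
    "row_candidates s (int s - 2) 2 = {[int k, 0, -1, 0, 1], [0, 2, -1, 0, 0]}"
    "row_candidates s (int s - 2) 3 = {[int k + 1, 1, 0, -1, 0]}"
    "row_candidates s (int s - 2) 4 = {[2 * int k + 2, 0, 0, 0, -1], [0, 1, 1, 0, -1]}"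
    "row_candidates s (int s - 1) 0 = {[-1, 0, 0, 0, 1]}"
    "row_candidates s (int s - 1) 1 = {[int k, -1, 0, 1, 0]}"
    "row_candidates s (int s - 1) 2 = {[int k + 1, 1, -1, 0, 0]}"
    "row_candidates s (int s - 1) 3 = {[2 * int k + 2, 0, 0, -1, 0], [0, 1, 1, -1, 0]}"
    "row_candidates s (int s - 1) 4 = {[int k + 1, 0, 1, 0, -1], [0, 1, 0, 1, -1]}"
    using factorizations by (simp_all add: row_candidates_def int_s add.commute insert_commute)
  have upt: "[0..<5] = [0, 1, 2, 3, 4::nat]" by (simp add: upt_rec)
  (* As images of finite sets, the products of row sets can be enumerated by rewriting. *)
  have cons: "set_Cons X Y = (\<lambda>(x, xs). x # xs) ` (X \<times> Y)" for X :: "int list set" and Y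
    by (auto simp: set_Cons_def)
  have card3: "card {A. is_RF_matrix S (int s - 3) A} = 2"
    using cards[of "int s - 3"] unfolding upt list.map rows by (simp add: PF cons)
  have card2: "card {A. is_RF_matrix S (int s - 2) A} = 4"
    using cards[of "int s - 2"] unfolding upt list.map rows by (simp add: PF cons)
  have card1: "card {A. is_RF_matrix S (int s - 1) A} = 4"
    using cards[of "int s - 1"] unfolding upt list.map rows by (simp add: PF cons)
  have mem: "int s - 5 \<in> PF S" "int s - 3 \<in> PF S" "int s - 2 \<in> PF S" "int s - 1 \<in> PF S"
    by (simp_all add: PF)
  show ?thesis
    by (intro conjI; (fact PF | fact card3 | fact card2 | fact card1
      | (unfold mem[THEN mats] upt list.map rows coeffs, auto simp: cons)))
qed

end
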